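(* For every $\theta\in(0,1)$ and $p\in[1,\infty)$ there exist constants $\delta_0=\delta_0(p,\theta)>0$ and $C(p,\theta)>0$, depending only on $p$ and $\theta$, such that the following holds. Let $I\subset\mathbb{R}$ be an open interval equipped with a probability measure $\mathfrak{m}=e^{-\psi}\,dx$, where $\psi:I\to\mathbb{R}$ is $1$-convex. Let $0<\delta<\delta_0$ and suppose that $$\mathfrak{m}\big((-\infty,a_\theta]\cap I\big)=\theta\qquad\text{and}\qquad e^{-\psi(a_\theta)}\le e^{-\boldsymbol{\psi}_{\mathrm g}(a_\theta)}+\delta .$$ Then $$\big\|e^{\boldsymbol{\psi}_{\mathrm g}-\psi}-1\big\|_{L^p(\boldsymbol{\gamma})}\le C(p,\theta)\,\delta^{1/p},$$ where $e^{\boldsymbol{\psi}_{\mathrm g}-\psi}:=0$ on $\mathbb{R}\setminus I$.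
   Context: A function $\psi:I\to\mathbb{R}$ on an interval is called $1$-convex if $\psi((1-t)x+ty)\le(1-t)\psi(x)+t\psi(y)-\tfrac12(1-t)t|x-y|^2$ for all $x,y\in I$ and $t\in(0,1)$. $\boldsymbol{\gamma}(dx)=(2\pi)^{-1/2}e^{-x^2/2}\,dx=e^{-\boldsymbol{\psi}_{\mathrm g}(x)}\,dx$ is the standard Gaussian measure on $\mathbb{R}$, so $\boldsymbol{\psi}_{\mathrm g}(x)=x^2/2+\tfrac12\log(2\pi)$. For $\theta\in(0,1)$, $a_\theta\in\mathbb{R}$ is defined by $\boldsymbol{\gamma}((-\infty,a_\theta])=\theta$. (The condition $\mathfrak{m}((-\infty,a_\theta]\cap I)=\theta\in(0,1)$ forces $a_\theta\in I$, so $\psi(a_\theta)$ makes sense.) *)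

theory Defs
  imports "HOL-Probability.Probability"
begin

text \<open>
  A function on an interval \<open>I\<close> is modelled by a total function of which only the values on
  \<open>I\<close> are ever used.
\<close>

definition one_convex_on :: "real set \<Rightarrow> (real \<Rightarrow> real) \<Rightarrow> bool" where
  "one_convex_on I \<psi> \<longleftrightarrow>
     (\<forall>x\<in>I. \<forall>y\<in>I. \<forall>t\<in>{0<..<1}.
        \<psi> ((1 - t) * x + t * y)
          \<le> (1 - t) * \<psi> x + t * \<psi> y - 1 / 2 * (1 - t) * t * \<bar>x - y\<bar>\<^sup>2)"

definition exp_measure :: "real set \<Rightarrow> (real \<Rightarrow> real) \<Rightarrow> real measure" where
  "exp_measure I \<psi> = density (restrict_space lborel I) (\<lambda>x. ennreal (exp (- \<psi> x)))"

definition gauss_potential :: "real \<Rightarrow> real" where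
  "gauss_potential x = x\<^sup>2 / 2 + 1 / 2 * ln (2 * pi)"

lemma exp_gauss_potential: "exp (- gauss_potential x) = std_normal_density x"
proof -
  have "exp (1 / 2 * ln (2 * pi)) = sqrt (2 * pi)"
    by (simp add: powr_half_sqrt [symmetric] powr_def)
  then have "exp (gauss_potential x) = exp (x\<^sup>2 / 2) * sqrt (2 * pi)"
    unfolding gauss_potential_def by (simp only: exp_add)
  moreover have "exp (- x\<^sup>2 / 2) = inverse (exp (x\<^sup>2 / 2))"
    by (simp only: exp_minus [symmetric] minus_divide_left)
  ultimately show ?thesis
    unfolding std_normal_density_def
    by (simp only: exp_minus inverse_mult_distrib divide_inverse mult_1_left mult.commute)
qed

definition gauss_quantile :: "real \<Rightarrow> real" where
  "gauss_quantile \<theta> = (THE a. measure std_normal_distribution {..a} = \<theta>)"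

text \<open>
  The norm takes the value \<open>\<infinity>\<close> when the integral diverges, so that an upper bound by a real
  number includes membership in \<open>L\<^sup>p\<close>. It is meant for \<open>1 \<le> p\<close> and \<open>M\<close>-measurable \<open>f\<close>.
\<close>

definition Lp_norm :: "real \<Rightarrow> 'a measure \<Rightarrow> ('a \<Rightarrow> real) \<Rightarrow> ennreal" where
  "Lp_norm p M f =
     (let J = (\<integral>\<^sup>+ x. ennreal (\<bar>f x\<bar> powr p) \<partial>M)
      in if J = \<infinity> then \<infinity> else ennreal (enn2real J powr (1 / p)))"

lemma gauss_quantile_ex1:
  assumes "0 < \<theta>" "\<theta> < 1"
  shows "\<exists>!a. measure std_normal_distribution {..a} = \<theta>"
proof -
  let ?G = "std_normal_distribution"
  interpret G: real_distribution ?G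
    by (rule real_dist_normal_dist)
  have null: "measure ?G {x} = 0" for x
  proof -
    have "emeasure ?G {x} = (\<integral>\<^sup>+ y. ennreal (std_normal_density y) * indicator {x} y \<partial>lborel)"
      by (subst emeasure_density) auto
    also have "\<dots> = 0"
      by (subst nn_integral_0_iff_AE) (auto intro!: AE_I[where N = "{x}"] simp: indicator_def)
    finally show ?thesis
      by (simp add: measure_def)
  qed
  have cont: "isCont (cdf ?G) x" for x
    using null[of x] by (simp add: G.isCont_cdf)
  have "eventually (\<lambda>x. cdf ?G x < \<theta>) at_bot"
    using order_tendstoD(2)[OF G.cdf_lim_at_bot \<open>0 < \<theta>\<close>] .
  then obtain l where l: "cdf ?G l < \<theta>"
    using eventually_happens trivial_limit_at_bot_linorder by blast
  have "eventually (\<lambda>x. cdf ?G x > \<theta>) at_top"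
    using order_tendstoD(1)[OF G.cdf_lim_at_top_prob \<open>\<theta> < 1\<close>] .
  then obtain u where u: "\<theta> < cdf ?G u"
    using eventually_happens trivial_limit_at_top_linorder by blast
  have "l \<le> u"
    using l u G.cdf_nondecreasing[of u l] by linarith
  then obtain a where a: "cdf ?G a = \<theta>"
    using IVT[of "cdf ?G" l \<theta> u] l u cont by auto
  have strict: "cdf ?G x < cdf ?G y" if "x < y" for x y
  proof -
    have "emeasure ?G {x<..y} \<noteq> 0"
    proof
      assume "emeasure ?G {x<..y} = 0"
      then have "(\<integral>\<^sup>+ z. ennreal (std_normal_density z) * indicator {x<..y} z \<partial>lborel) = 0"
        by (simp add: emeasure_density)
      then have "AE z in lborel. ennreal (std_normal_density z) * indicator {x<..y} z = 0"
        by (subst (asm) nn_integral_0_iff_AE) auto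
      then have "AE z in lborel. z \<notin> {x<..y}"
      proof (rule eventually_mono)
        fix z
        assume "ennreal (std_normal_density z) * indicator {x<..y} z = 0"
        with normal_density_pos[of 1 0 z] show "z \<notin> {x<..y}"
          by (auto simp: indicator_def ennreal_eq_0_iff split: if_splits)
      qed
      then have "emeasure lborel {x<..y} = 0"
        by (subst (asm) AE_iff_measurable[where N = "{x<..y}"]) auto
      with that show False
        by simp
    qed
    then have "0 < measure ?G {x<..y}"
      by (simp add: G.emeasure_eq_measure less_le)
    then show ?thesis
      using G.cdf_diff_eq[OF that] by linarith
  qed
  have "b = a" if "cdf ?G b = \<theta>" for b
    using strict[of a b] strict[of b a] a that by (cases a b rule: linorder_cases) auto
  with a show ?thesis
    unfolding cdf_def by blast
qed

end

theory Submission
  imports Defs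
begin

text \<open>
  Since \<open>\<psi> - gauss_potential\<close> is convex on \<open>I\<close>, a supporting line at the quantile \<open>a\<close> bounds the density
  \<open>f\<close> of the measure relative to the Gaussian: \<open>f x \<le> (1 + \<epsilon>) exp (s (x - a))\<close>, where \<open>\<epsilon>\<close> is
  \<open>\<delta>\<close> over the Gaussian density at \<open>a\<close>. On the half line where \<open>s (x - a) \<le> 0\<close>, \<open>f\<close> has the same mass
  as the constant 1, which forces \<open>\<bar>s\<bar> = O(\<epsilon>)\<close>. Hence \<open>f \<le> 1 + \<epsilon> W\<close> with \<open>W x = exp (C \<bar>x - a\<bar>)\<close>,
  which has all Gaussian moments. As \<open>f\<close> has mean 1, its deficit below 1 has the same integral as
  its excess above 1; this gives the pointwise bound \<open>\<bar>f - 1\<bar>\<^sup>p \<le> \<epsilon> (W\<^sup>p + W) + (1 - f)\<close>, whose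
  last term integrates to 0.
\<close>

section \<open>Controlling the slope by equality of masses\<close>

text \<open>For \<open>s \<le> 1\<close> this is convexity of \<open>exp\<close> on the chord from 0
  to \<open>- u\<close>; for larger \<open>s\<close> it is monotonicity. The right side separates
  the slope from the position, so that after integration the loss of mass is \<open>min s 1\<close>
  times a constant independent of \<open>s\<close>.\<close>

lemma exp_neg_mult_le:
  fixes s u :: real
  assumes "0 \<le> s" "0 \<le> u"
  shows "exp (- (s * u)) \<le> 1 - min s 1 * (1 - exp (- u))"
proof (cases "s \<le> 1")
  case True
  have "exp ((1 - s) *\<^sub>R 0 + s *\<^sub>R (- u)) \<le> (1 - s) * exp 0 + s * exp (- u)"
    by (rule convex_onD[OF exp_convex]) (use assms True in auto)
  with True show ?thesis
    by (simp add: algebra_simps)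
next
  case False
  with assms have "1 * u \<le> s * u"
    by (intro mult_right_mono) auto
  with False show ?thesis
    by simp
qed

text \<open>A strict inequality almost everywhere on a set of positive measure stays strict after
  integration. This gives the positivity of the constant \<open>c\<close> in the slope bound
  below.\<close>

lemma (in finite_measure) set_integral_deficit_pos:
  fixes A :: "'a set" and g :: "'a \<Rightarrow> real"
  assumes "A \<in> sets M" "0 < measure M A" "AE x in M. x \<in> A \<longrightarrow> g x < 1"
    and "set_integrable M A g"
  shows "0 < measure M A - (LINT x:A|M. g x)"
proof -
  have "integral\<^sup>L M (\<lambda>x. indicator A x * g x) < integral\<^sup>L M (indicator A :: 'a \<Rightarrow> real)"
  proof (rule integral_less_AE[where A = A])
    show "emeasure M A \<noteq> 0"
      using assms(2) by (auto simp: measure_def)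
    show "AE x in M. x \<in> A \<longrightarrow> indicat_real A x * g x \<noteq> indicat_real A x"
      using assms(3) by eventually_elim auto
    show "AE x in M. indicat_real A x * g x \<le> indicat_real A x"
      using assms(3) by eventually_elim (auto simp: indicator_def)
    show "integrable M (\<lambda>x. indicat_real A x * g x)"
      using assms(4) by (simp add: set_integrable_def)
    show "integrable M (indicat_real A)"
      using assms(1) by (simp add: integrable_indicator_iff less_top[symmetric])
  qed (use assms in auto)
  then show ?thesis
    using assms(1) by (simp add: set_lebesgue_integral_def)
qed

text \<open>A steep exponential would lose too much mass on \<open>A\<close>. Integrating the bound
  on \<open>f\<close>, with \<open>exp_neg_mult_le\<close> applied to the exponential, gives
  \<open>measure M A \<le> (1 + \<epsilon>) * (measure M A - min s 1 * c)\<close>, hence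
  \<open>min s 1 * c \<le> \<epsilon>\<close>.\<close>

lemma slope_le_of_mass:
  fixes M :: "real measure" and f :: "real \<Rightarrow> real" and A :: "real set" and a :: real
  defines "c \<equiv> measure M A - (LINT x:A|M. exp (- \<bar>x - a\<bar>))"
  assumes "prob_space M" and M: "sets M = sets borel" and A: "A \<in> sets M"
    and f: "set_integrable M A f" and le: "\<And>x. x \<in> A \<Longrightarrow> f x \<le> (1 + \<epsilon>) * exp (- (s * \<bar>x - a\<bar>))"
    and mass: "(LINT x:A|M. f x) = measure M A"
    and "0 \<le> s" "0 \<le> \<epsilon>" "\<epsilon> < c"
  shows "s \<le> \<epsilon> / c"
proof -
  interpret prob_space M by fact
  have [measurable]: "A \<in> sets borel" "A \<in> sets M" "id \<in> borel_measurable M"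
    using A M by (auto cong: measurable_cong_sets)
  have E: "set_integrable M A (\<lambda>x. exp (- \<bar>x - a\<bar>))"
    unfolding set_integrable_def
    by (rule integrable_const_bound[where B = 1])
      (auto simp: indicator_def M cong: measurable_cong_sets)
  have one: "set_integrable M A (\<lambda>x. 1::real)"
    unfolding set_integrable_def
    by (rule integrable_const_bound[where B = 1]) (auto simp: indicator_def)
  have D: "set_integrable M A (\<lambda>x. 1 - min s 1 * (1 - exp (- \<bar>x - a\<bar>)))"
    by (intro set_integral_diff set_integrable_mult_right one E)
  have "measure M A \<le> (LINT x:A|M. (1 + \<epsilon>) * (1 - min s 1 * (1 - exp (- \<bar>x - a\<bar>))))"
    unfolding mass[symmetric]
  proof (rule set_integral_mono[OF f])
    show "f x \<le> (1 + \<epsilon>) * (1 - min s 1 * (1 - exp (- \<bar>x - a\<bar>)))" if "x \<in> A" for x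
      using le[OF that] exp_neg_mult_le[of s "\<bar>x - a\<bar>"] \<open>0 \<le> s\<close> \<open>0 \<le> \<epsilon>\<close>
      by (elim order_trans, intro mult_left_mono) auto
  qed (intro set_integrable_mult_right D)
  also have "\<dots> = (1 + \<epsilon>) * (measure M A - min s 1 * c)"
    using E one by (simp add: c_def set_integral_diff set_integrable_mult_right)
      (simp add: set_lebesgue_integral_def)
  finally have "(1 + \<epsilon>) * (min s 1 * c) \<le> \<epsilon> * measure M A"
    by (simp add: algebra_simps)
  moreover have "\<epsilon> * measure M A \<le> \<epsilon> * 1"
    using \<open>0 \<le> \<epsilon>\<close> by (intro mult_left_mono) auto
  moreover have "1 * (min s 1 * c) \<le> (1 + \<epsilon>) * (min s 1 * c)"
    using \<open>0 \<le> \<epsilon>\<close> \<open>0 \<le> s\<close> \<open>\<epsilon> < c\<close> by (intro mult_right_mono) auto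
  ultimately have "min s 1 * c \<le> \<epsilon>"
    by linarith
  \<comment> \<open>The case \<open>s > 1\<close> would give \<open>c \<le> \<epsilon>\<close>, so
    the minimum is \<open>s\<close> itself.\<close>
  with \<open>\<epsilon> < c\<close> \<open>0 \<le> \<epsilon>\<close> show ?thesis
    by (auto simp: min_def pos_le_divide_eq split: if_splits)
qed

section \<open>From a one-sided pointwise bound to the p-th moment\<close>

lemma (in prob_space) nn_integral_powr_diff_one_le:
  fixes f W :: "'a \<Rightarrow> real"
  assumes f: "integrable M f" "(LINT x|M. f x) = 1" "\<And>x. 0 \<le> f x"
    and le: "\<And>x. f x \<le> 1 + \<epsilon> * W x" and W: "\<And>x. 0 \<le> W x"
    and int: "integrable M W" "integrable M (\<lambda>x. W x powr p)"
    and "0 \<le> \<epsilon>" "\<epsilon> \<le> 1" "1 \<le> p"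
  shows "(\<integral>\<^sup>+x. ennreal (\<bar>f x - 1\<bar> powr p) \<partial>M)
    \<le> ennreal (\<epsilon> * ((LINT x|M. W x powr p) + (LINT x|M. W x)))"
proof -
  \<comment> \<open>The summand \<open>\<epsilon> * W x\<close> compensates for
    \<open>1 - f x\<close> being negative where \<open>f\<close> exceeds 1.\<close>
  define g where "g x = \<epsilon> * (W x powr p + W x) + (1 - f x)" for x
  have point: "\<bar>f x - 1\<bar> powr p \<le> g x" for x
  proof (cases "1 \<le> f x")
    case True
    have "(f x - 1) powr p \<le> (\<epsilon> * W x) powr p"
      using True le[of x] \<open>1 \<le> p\<close> by (intro powr_mono2) auto
    also have "\<dots> = \<epsilon> powr p * W x powr p"
      using \<open>0 \<le> \<epsilon>\<close> W by (simp add: powr_mult)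
    also have "\<dots> \<le> \<epsilon> powr 1 * W x powr p"
      using \<open>0 \<le> \<epsilon>\<close> \<open>\<epsilon> \<le> 1\<close> \<open>1 \<le> p\<close>
      by (intro mult_right_mono powr_mono') auto
    finally show ?thesis
      using True le[of x] \<open>0 \<le> \<epsilon>\<close> by (simp add: g_def algebra_simps)
  next
    case False
    \<comment> \<open>The deficit lies between 0 and 1, so its p-th power is controlled only by its
      first power. Its integral is of order \<open>\<epsilon>\<close>, which leads to the exponent
      \<open>1 / p\<close> in the final rate.\<close>
    then have "(1 - f x) powr p \<le> (1 - f x) powr 1"
      using f(3)[of x] \<open>1 \<le> p\<close> by (intro powr_mono') auto
    moreover have "0 \<le> \<epsilon> * (W x powr p + W x)"
      using W \<open>0 \<le> \<epsilon>\<close> by simp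
    ultimately show ?thesis
      using False by (simp add: g_def abs_if)
  qed
  have "integrable M g"
    unfolding g_def
    by (intro Bochner_Integration.integrable_add integrable_mult_right
      Bochner_Integration.integrable_diff f int) simp
  have "(\<integral>\<^sup>+x. ennreal (\<bar>f x - 1\<bar> powr p) \<partial>M) \<le> (\<integral>\<^sup>+x. ennreal (g x) \<partial>M)"
    by (intro nn_integral_mono ennreal_leI point)
  also have "\<dots> = ennreal (LINT x|M. g x)"
    using \<open>integrable M g\<close> order_trans[OF powr_ge_zero point] by (intro nn_integral_eq_integral) auto
  also have "(LINT x|M. g x) = \<epsilon> * ((LINT x|M. W x powr p) + (LINT x|M. W x))"
    using int f by (simp add: g_def prob_space)
  finally show ?thesis .
qed

section \<open>Gaussian integrability, convexity and an elementary inequality\<close>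

lemma integrable_std_normal_exp_abs:
  "integrable std_normal_distribution (\<lambda>x. exp (t * \<bar>x - a\<bar>))"
proof -
  have shift: "integrable lborel (\<lambda>x. std_normal_density x * exp (r * x))" for r
  proof -
    \<comment> \<open>Completing the square turns the exponential tilt into a shift of the
      mean.\<close>
    have "std_normal_density x * exp (r * x) = exp (r\<^sup>2 / 2) * normal_density r 1 x" for x
      by (simp add: normal_density_def exp_add[symmetric] power2_eq_square field_simps)
    then show ?thesis
      by simp
  qed
  have "integrable lborel (\<lambda>x. std_normal_density x * exp (t * \<bar>x - a\<bar>))"
  proof (rule Bochner_Integration.integrable_bound)
    show "integrable lborel (\<lambda>x. exp (- t * a) * (std_normal_density x * exp (t * x))
        + exp (t * a) * (std_normal_density x * exp (- t * x)))"
      by (intro Bochner_Integration.integrable_add integrable_mult_right shift)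
    have "exp (t * \<bar>x - a\<bar>) \<le> exp (- t * a) * exp (t * x) + exp (t * a) * exp (- t * x)" for x
      by (auto simp: abs_if exp_add[symmetric] algebra_simps)
    then have "std_normal_density x * exp (t * \<bar>x - a\<bar>)
      \<le> std_normal_density x * (exp (- t * a) * exp (t * x) + exp (t * a) * exp (- t * x))" for x
      by (intro mult_left_mono) auto
    then show "AE x in lborel. norm (std_normal_density x * exp (t * \<bar>x - a\<bar>))
        \<le> norm (exp (- t * a) * (std_normal_density x * exp (t * x))
        + exp (t * a) * (std_normal_density x * exp (- t * x)))"
      by (intro AE_I2) (simp add: algebra_simps abs_of_nonneg)
  qed simp
  then show ?thesis
    by (subst integrable_density) auto
qed

lemma std_normal_singleton: "emeasure std_normal_distribution {a} = 0"
  by (subst emeasure_density) (auto intro!: nn_integral_null_set)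

text \<open>The convexity gap of \<open>x\<^sup>2 / 2\<close> is exactly the quadratic term in the
  definition of 1-convexity, so subtracting the Gaussian potential cancels it.\<close>

lemma one_convex_on_imp_convex_on:
  assumes "one_convex_on I \<psi>" "is_interval I"
  shows "convex_on I (\<lambda>x. \<psi> x - gauss_potential x)"
proof (rule convex_onI)
  fix t x y :: real
  assume *: "0 < t" "t < 1" "x \<in> I" "y \<in> I"
  have "\<psi> ((1 - t) * x + t * y)
      \<le> (1 - t) * \<psi> x + t * \<psi> y - 1 / 2 * (1 - t) * t * \<bar>x - y\<bar>\<^sup>2"
    using assms(1) * unfolding one_convex_on_def by auto
  then show "\<psi> ((1 - t) *\<^sub>R x + t *\<^sub>R y) - gauss_potential ((1 - t) *\<^sub>R x + t *\<^sub>R y)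
      \<le> (1 - t) * (\<psi> x - gauss_potential x) + t * (\<psi> y - gauss_potential y)"
    by (simp add: gauss_potential_def power2_eq_square field_simps)
qed (use assms in \<open>simp add: is_interval_convex\<close>)

text \<open>Extracts one factor \<open>\<epsilon>\<close> from the excess over 1:
  \<open>1 - \<epsilon> * r \<le> exp (- (\<epsilon> * r))\<close> linearizes the exponential, and
  \<open>1 + r \<le> exp r\<close> together with \<open>\<epsilon> \<le> 1\<close> absorbs the rest
  into \<open>exp (2 * r)\<close>.\<close>

lemma one_plus_mult_exp_le:
  fixes \<epsilon> r :: real
  assumes "0 \<le> \<epsilon>" "\<epsilon> \<le> 1" "0 \<le> r"
  shows "(1 + \<epsilon>) * exp (\<epsilon> * r) \<le> 1 + \<epsilon> * exp (2 * r)"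
proof -
  have "1 - \<epsilon> * r \<le> exp (- (\<epsilon> * r))"
    using exp_ge_add_one_self[of "- (\<epsilon> * r)"] by simp
  then have "(1 - \<epsilon> * r) * exp (\<epsilon> * r) \<le> exp (- (\<epsilon> * r)) * exp (\<epsilon> * r)"
    by (rule mult_right_mono) simp
  then have "(1 + \<epsilon>) * exp (\<epsilon> * r) \<le> 1 + \<epsilon> * ((1 + r) * exp (\<epsilon> * r))"
    by (simp add: exp_minus algebra_simps)
  also have "(1 + r) * exp (\<epsilon> * r) \<le> exp r * exp r"
    using assms by (intro mult_mono) (auto intro: mult_left_le_one_le)
  also have "\<dots> = exp (2 * r)"
    by (simp add: exp_add[symmetric])
  finally show ?thesis
    using assms by (simp add: mult_left_mono)
qed

section \<open>Densities relative to the Gaussian measure\<close>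

definition relative_density :: "real set \<Rightarrow> (real \<Rightarrow> real) \<Rightarrow> real \<Rightarrow> real" where
  "relative_density I \<psi> x = (if x \<in> I then exp (gauss_potential x - \<psi> x) else 0)"

lemma relative_density_nonneg: "0 \<le> relative_density I \<psi> x"
  by (simp add: relative_density_def)

lemma borel_measurable_relative_density:
  assumes "open I" "continuous_on I \<psi>"
  shows "relative_density I \<psi> \<in> borel_measurable borel"
proof -
  have "relative_density I \<psi> = (\<lambda>x. indicator I x *\<^sub>R exp (gauss_potential x - \<psi> x))"
    by (auto simp: relative_density_def indicator_def)
  also have "\<dots> \<in> borel_measurable borel"
    using assms unfolding gauss_potential_def
    by (intro borel_measurable_continuous_on_indicator continuous_intros) auto
  finally show ?thesis .
qed

lemma space_exp_measure [simp]: "space (exp_measure I \<psi>) = I"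
  by (simp add: exp_measure_def space_restrict_space)

lemma sets_exp_measure: "sets (exp_measure I \<psi>) = sets (restrict_space lborel I)"
  by (simp add: exp_measure_def)

lemma emeasure_exp_measure:
  assumes "open I" "continuous_on I \<psi>" "B \<in> sets borel"
  shows "emeasure (exp_measure I \<psi>) (B \<inter> I)
    = (\<integral>\<^sup>+x. ennreal (relative_density I \<psi> x * indicator B x) \<partial>std_normal_distribution)"
proof -
  have meas: "(\<lambda>x. ennreal (exp (- \<psi> x))) \<in> borel_measurable (restrict_space lborel I)"
  proof -
    have "(\<lambda>x. exp (- \<psi> x)) \<in> borel_measurable (restrict_space borel I)"
      using assms by (intro borel_measurable_continuous_on_restrict continuous_intros)
    then have "(\<lambda>x. exp (- \<psi> x)) \<in> borel_measurable (restrict_space lborel I)"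
      by (simp cong: measurable_cong_sets add: sets_restrict_space)
    then show ?thesis
      by measurable
  qed
  have "B \<inter> I \<in> sets (restrict_space lborel I)"
    using assms by (auto simp: sets_restrict_space)
  then have "emeasure (exp_measure I \<psi>) (B \<inter> I)
      = (\<integral>\<^sup>+x. ennreal (exp (- \<psi> x)) * indicator (B \<inter> I) x * indicator I x \<partial>lborel)"
    using meas assms unfolding exp_measure_def
    by (simp add: emeasure_density nn_integral_restrict_space)
  also have "\<dots> = (\<integral>\<^sup>+x. ennreal (std_normal_density x)
      * ennreal (relative_density I \<psi> x * indicator B x) \<partial>lborel)"
    by (intro nn_integral_cong)
      (auto simp: relative_density_def indicator_def ennreal_mult[symmetric] exp_add[symmetric]
        exp_gauss_potential[symmetric])
  also have "\<dots> = (\<integral>\<^sup>+x. ennreal (relative_density I \<psi> x * indicator B x) \<partial>std_normal_distribution)"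
    using borel_measurable_relative_density[OF assms(1,2)] assms(3)
    by (subst nn_integral_density) auto
  finally show ?thesis .
qed

text \<open>Turns the mass hypotheses into Bochner integrals against the Gaussian. Integrability is
  automatic because the nonnegative integral is the mass of a probability measure.\<close>

lemma integral_relative_density:
  assumes "open I" "continuous_on I \<psi>" "prob_space (exp_measure I \<psi>)" "B \<in> sets borel"
  shows "set_integrable std_normal_distribution B (relative_density I \<psi>)"
    and "(LINT x:B|std_normal_distribution. relative_density I \<psi> x)
      = measure (exp_measure I \<psi>) (B \<inter> I)"
proof -
  interpret P: prob_space "exp_measure I \<psi>" by fact
  let ?g = "\<lambda>x. indicator B x *\<^sub>R relative_density I \<psi> x"
  have eq: "(\<integral>\<^sup>+x. ennreal (?g x) \<partial>std_normal_distribution)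
      = ennreal (measure (exp_measure I \<psi>) (B \<inter> I))"
    using emeasure_exp_measure[OF assms(1,2,4)] by (simp add: P.emeasure_eq_measure mult.commute)
  have m: "?g \<in> borel_measurable std_normal_distribution"
    using borel_measurable_relative_density[OF assms(1,2)] assms(4) by simp
  have nn: "0 \<le> ?g x" for x
    by (simp add: relative_density_nonneg)
  show "set_integrable std_normal_distribution B (relative_density I \<psi>)"
    unfolding set_integrable_def by (rule integrableI_nonneg[OF m]) (use nn eq in auto)
  show "(LINT x:B|std_normal_distribution. relative_density I \<psi> x)
      = measure (exp_measure I \<psi>) (B \<inter> I)"
    unfolding set_lebesgue_integral_def
    using m nn eq by (subst integral_eq_nn_integral) auto
qed

text \<open>An interval that misses \<open>a\<close> lies entirely on one side of it, so the half
  line would carry mass 0 or 1.\<close>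

lemma mem_of_measure_atMost:
  assumes "is_interval I" "prob_space (exp_measure I \<psi>)"
    and "0 < measure (exp_measure I \<psi>) ({..a} \<inter> I)" "measure (exp_measure I \<psi>) ({..a} \<inter> I) < 1"
  shows "a \<in> I"
proof (rule ccontr)
  assume "a \<notin> I"
  interpret P: prob_space "exp_measure I \<psi>" by fact
  have "{..a} \<inter> I = {} \<or> {..a} \<inter> I = I"
  proof (rule ccontr)
    assume "\<not> ?thesis"
    then obtain x y where "x \<in> I" "x \<le> a" "y \<in> I" "a \<le> y"
      by (force simp: not_le)
    with \<open>a \<notin> I\<close> assms(1) show False
      by (meson is_interval_1)
  qed
  with assms P.prob_space show False
    by auto
qed

section \<open>Choice of constants and the final estimate\<close>

theorem proposition2p2:
  fixes \<theta> p :: real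
  assumes "0 < \<theta>" and "\<theta> < 1" and "1 \<le> p"
  shows "\<exists>\<delta>\<^sub>0 > 0. \<exists>C > 0.
    \<forall>(I :: real set) (\<psi> :: real \<Rightarrow> real) (\<delta> :: real).
      open I \<longrightarrow> is_interval I \<longrightarrow> one_convex_on I \<psi> \<longrightarrow> prob_space (exp_measure I \<psi>) \<longrightarrow>
      0 < \<delta> \<longrightarrow> \<delta> < \<delta>\<^sub>0 \<longrightarrow>
      measure (exp_measure I \<psi>) ({..gauss_quantile \<theta>} \<inter> I) = \<theta> \<longrightarrow>
      exp (- \<psi> (gauss_quantile \<theta>)) \<le> exp (- gauss_potential (gauss_quantile \<theta>)) + \<delta> \<longrightarrow>
      Lp_norm p std_normal_distribution
          (\<lambda>x. (if x \<in> I then exp (gauss_potential x - \<psi> x) else 0) - 1)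
        \<le> ennreal (C * \<delta> powr (1 / p))"
proof -
  define a where "a = gauss_quantile \<theta>"
  let ?G = std_normal_distribution
  interpret G: prob_space ?G
    by (rule prob_space_normal_density) simp
  have left: "measure ?G {..a} = \<theta>"
    unfolding a_def gauss_quantile_def using gauss_quantile_ex1[OF assms(1,2)] by (rule theI')
  have right: "measure ?G {a<..} = 1 - \<theta>"
    using G.prob_compl[of "{..a}"] left by (simp add: Compl_eq_Diff_UNIV[symmetric])
  define c where "c A = measure ?G A - (LINT x:A|?G. exp (- \<bar>x - a\<bar>))" for A
  have c_pos: "0 < c A" if "A \<in> sets borel" "0 < measure ?G A" for A
    unfolding c_def
  proof (rule G.set_integral_deficit_pos)
    \<comment> \<open>The exponential equals 1 only at \<open>a\<close>, a Gaussian null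
      set.\<close>
    have "AE x in ?G. x \<noteq> a"
      by (rule AE_I[where N = "{a}"]) (auto simp: std_normal_singleton)
    then show "AE x in ?G. x \<in> A \<longrightarrow> exp (- \<bar>x - a\<bar>) < 1"
      by eventually_elim simp
    show "set_integrable ?G A (\<lambda>x. exp (- \<bar>x - a\<bar>))"
      unfolding set_integrable_def using that
      by (intro G.integrable_const_bound[where B = 1]) (auto simp: indicator_def)
  qed (use that in auto)
  \<comment> \<open>The sign of the slope is not known in advance, so \<open>k\<close> has to serve
    both half lines.\<close>
  define k where "k = min (c {..a}) (c {a<..})"
  have k: "0 < k" "k \<le> c {..a}" "k \<le> c {a<..}"
    using c_pos[of "{..a}"] c_pos[of "{a<..}"] left right assms by (auto simp: k_def)
  \<comment> \<open>This is \<open>exp (2 * r)\<close> from \<open>one_plus_mult_exp_le\<close> with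
    \<open>r = \<bar>x - a\<bar> / k\<close>, since the slope will be at most
    \<open>\<epsilon> / k\<close>.\<close>
  define W where "W x = exp (2 / k * \<bar>x - a\<bar>)" for x
  have W_nonneg: "0 \<le> W x" for x
    by (simp add: W_def)
  have W: "integrable ?G W" "integrable ?G (\<lambda>x. W x powr p)"
    unfolding W_def exp_powr_real using integrable_std_normal_exp_abs[of "2 / k" a]
      integrable_std_normal_exp_abs[of "2 / k * p" a] by (simp_all add: mult_ac)
  define D where "D = (LINT x|?G. W x powr p) + (LINT x|?G. W x)"
  have D: "0 \<le> D"
    unfolding D_def by (intro add_nonneg_nonneg integral_nonneg) (auto simp: W_def)
  define \<phi> where "\<phi> = exp (- gauss_potential a)"
  have "0 < \<phi>"
    by (simp add: \<phi>_def)
  \<comment> \<open>All constants are fixed before \<open>I\<close>, \<open>\<psi>\<close> and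
    \<open>\<delta>\<close> appear, so they depend on \<open>\<theta>\<close> and \<open>p\<close>
    only. The threshold on \<open>\<delta>\<close> encodes \<open>\<epsilon> \<le> 1\<close> and
    \<open>\<epsilon> < k\<close>; the added 1 makes the constant visibly positive.\<close>
  have main: "Lp_norm p ?G (\<lambda>x. relative_density I \<psi> x - 1)
      \<le> ennreal (((D / \<phi>) powr (1 / p) + 1) * \<delta> powr (1 / p))"
    if I: "open I" "is_interval I" and convex: "one_convex_on I \<psi>"
      and prob: "prob_space (exp_measure I \<psi>)" and \<delta>: "0 < \<delta>" "\<delta> < \<phi> * min 1 k"
      and mass: "measure (exp_measure I \<psi>) ({..a} \<inter> I) = \<theta>"
      and upper: "exp (- \<psi> a) \<le> exp (- gauss_potential a) + \<delta>"
    for I \<psi> \<delta>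
  proof -
    interpret P: prob_space "exp_measure I \<psi>" by fact
    let ?f = "relative_density I \<psi>"
    define \<epsilon> where "\<epsilon> = \<delta> / \<phi>"
    have \<epsilon>: "0 < \<epsilon>" "\<epsilon> \<le> 1" "\<epsilon> < k"
    proof -
      have "\<epsilon> < min 1 k"
        using \<delta>(2) \<open>0 < \<phi>\<close> by (simp only: \<epsilon>_def pos_divide_less_eq mult.commute)
      then show "0 < \<epsilon>" "\<epsilon> \<le> 1" "\<epsilon> < k"
        using \<delta>(1) \<open>0 < \<phi>\<close> by (auto simp: \<epsilon>_def)
    qed
    have "a \<in> I"
      using mem_of_measure_atMost[OF I(2) prob, of a] mass assms by simp
    have conv: "convex_on I (\<lambda>x. \<psi> x - gauss_potential x)"
      by (rule one_convex_on_imp_convex_on[OF convex I(2)])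
    have "continuous_on I (\<lambda>x. (\<psi> x - gauss_potential x) + gauss_potential x)"
      unfolding gauss_potential_def
      by (intro continuous_intros convex_on_continuous[OF I(1) conv, unfolded gauss_potential_def]) simp
    then have cont: "continuous_on I \<psi>"
      by simp
    note density = integral_relative_density[OF I(1) cont prob]
    \<comment> \<open>A supporting line at the interior point \<open>a\<close>. Here
      \<open>s\<close> is minus a subgradient, so that it appears with a plus sign in the exponent
      of the density bound.\<close>
    obtain s where s: "\<psi> x - gauss_potential x \<ge> \<psi> a - gauss_potential a - s * (x - a)"
      if "x \<in> I" for x
      using convex_le_Inf_differential[OF conv, of a] \<open>a \<in> I\<close> I(1)
      by (metis diff_minus_eq_add interior_open minus_mult_left)
    have peak: "exp (gauss_potential a - \<psi> a) \<le> 1 + \<epsilon>"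
    proof -
      have "exp (gauss_potential a - \<psi> a) = exp (- \<psi> a) / \<phi>"
        by (simp add: \<phi>_def exp_diff[symmetric])
      also have "\<dots> \<le> (\<phi> + \<delta>) / \<phi>"
        using upper \<open>0 < \<phi>\<close> by (intro divide_right_mono) (auto simp: \<phi>_def)
      finally show ?thesis
        using \<open>0 < \<phi>\<close> by (simp add: \<epsilon>_def add_divide_distrib)
    qed
    have line: "?f x \<le> (1 + \<epsilon>) * exp (s * (x - a))" for x
    proof (cases "x \<in> I")
      case True
      have "?f x \<le> exp (gauss_potential a - \<psi> a) * exp (s * (x - a))"
        using s[OF True] True by (simp add: relative_density_def exp_add[symmetric])
      also have "\<dots> \<le> (1 + \<epsilon>) * exp (s * (x - a))"
        using peak by (intro mult_right_mono) auto
      finally show ?thesis .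
    qed (use \<epsilon> in \<open>simp add: relative_density_def\<close>)
    have mass': "measure (exp_measure I \<psi>) ({a<..} \<inter> I) = 1 - \<theta>"
    proof -
      have "{..a} \<inter> I \<in> sets (exp_measure I \<psi>)"
        using I by (auto simp: sets_exp_measure sets_restrict_space)
      moreover have "{a<..} \<inter> I = I - {..a} \<inter> I"
        by auto
      ultimately show ?thesis
        using P.prob_compl[of "{..a} \<inter> I"] mass by simp
    qed
    have slope: "\<bar>s\<bar> \<le> \<epsilon> / k"
    proof -
      have "r \<le> \<epsilon> / k" if "0 \<le> r" "A \<in> sets borel" "k \<le> c A"
        "\<And>x. x \<in> A \<Longrightarrow> s * (x - a) = - (r * \<bar>x - a\<bar>)"
        "measure (exp_measure I \<psi>) (A \<inter> I) = measure ?G A" for r A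
      proof -
        have "r \<le> \<epsilon> / c A"
          unfolding c_def
        proof (rule slope_le_of_mass[OF G.prob_space_axioms])
          show "?f x \<le> (1 + \<epsilon>) * exp (- (r * \<bar>x - a\<bar>))" if "x \<in> A" for x
            using line[of x] \<open>x \<in> A \<Longrightarrow> s * (x - a) = - (r * \<bar>x - a\<bar>)\<close> that by simp
        qed (use that density[of A] \<epsilon> in \<open>auto simp: c_def\<close>)
        also have "\<dots> \<le> \<epsilon> / k"
          using k(1) that(3) \<epsilon> by (intro divide_left_mono) auto
        finally show ?thesis .
      qed
      \<comment> \<open>The half line is the one on which the exponential decays away from
        \<open>a\<close>: the left one for \<open>s \<ge> 0\<close>, the right one
        otherwise.\<close>
      from this[of s "{..a}"] this[of "- s" "{a<..}"] show ?thesis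
        using k mass mass' left right by (cases "0 \<le> s") (auto simp: abs_if algebra_simps)
    qed
    have "?f x \<le> 1 + \<epsilon> * W x" for x
    proof -
      have "s * (x - a) \<le> \<bar>s\<bar> * \<bar>x - a\<bar>"
        by (metis abs_ge_self abs_mult)
      also have "\<dots> \<le> \<epsilon> / k * \<bar>x - a\<bar>"
        using slope by (rule mult_right_mono) simp
      finally have "exp (s * (x - a)) \<le> exp (\<epsilon> * (\<bar>x - a\<bar> / k))"
        by simp
      then have "(1 + \<epsilon>) * exp (s * (x - a)) \<le> (1 + \<epsilon>) * exp (\<epsilon> * (\<bar>x - a\<bar> / k))"
        using \<epsilon> by (intro mult_left_mono) auto
      also have "\<dots> \<le> 1 + \<epsilon> * exp (2 * (\<bar>x - a\<bar> / k))"
        using \<epsilon> k by (intro one_plus_mult_exp_le) auto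
      finally show ?thesis
        using line[of x] by (simp add: W_def)
    qed
    moreover have "integrable ?G ?f" "(LINT x|?G. ?f x) = 1"
      using density[of UNIV] P.prob_space
      by (simp_all add: set_integrable_def set_lebesgue_integral_def)
    ultimately have J: "(\<integral>\<^sup>+x. ennreal (\<bar>?f x - 1\<bar> powr p) \<partial>?G) \<le> ennreal (\<epsilon> * D)"
      unfolding D_def using W \<epsilon> assms
      by (intro G.nn_integral_powr_diff_one_le)
        (auto simp: W_nonneg relative_density_nonneg)
    \<comment> \<open>Finiteness selects the real-valued branch of \<open>Lp_norm\<close>.\<close>
    then have "(\<integral>\<^sup>+x. ennreal (\<bar>?f x - 1\<bar> powr p) \<partial>?G) \<noteq> \<infinity>"
      by (auto simp: top_unique)
    moreover have "enn2real (\<integral>\<^sup>+x. ennreal (\<bar>?f x - 1\<bar> powr p) \<partial>?G) \<le> D / \<phi> * \<delta>"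
      using J \<delta>(1) \<open>0 < \<phi>\<close> D by (intro enn2real_leI) (auto simp: \<epsilon>_def mult.commute)
    then have "enn2real (\<integral>\<^sup>+x. ennreal (\<bar>?f x - 1\<bar> powr p) \<partial>?G) powr (1 / p)
        \<le> (D / \<phi> * \<delta>) powr (1 / p)"
      using assms by (intro powr_mono2) auto
    moreover have "\<dots> = (D / \<phi>) powr (1 / p) * \<delta> powr (1 / p)"
      by (rule powr_mult)
    ultimately show ?thesis
      unfolding Lp_norm_def Let_def
      by (auto intro!: ennreal_leI simp: algebra_simps intro: add_increasing)
  qed
  show ?thesis
  proof (intro exI conjI allI impI)
    show "0 < \<phi> * min 1 k"
      using \<open>0 < \<phi>\<close> k by simp
    show "0 < (D / \<phi>) powr (1 / p) + 1"
      by (intro add_nonneg_pos) auto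
  qed (use main in \<open>simp add: relative_density_def a_def\<close>)
qed

end
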